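(* Let $F$ be a bimonad on a 0-cell $\mathcal A$ of a 2-category $\mathcal K$ with $\lambda=(\mu\times F)\circ(F\times\tau_{F,F})\circ(\Delta\times F)$, where $\tau_{F,F}:FF\to FF$ is left and right monadic and left and right comonadic. Let $X:\mathcal A\to\mathcal A$ be a 1-cell with 2-cells $\tau_{F,X}:FX\to XF$, $\tau_{X,F}:XF\to FX$, a left $F$-module structure $\nu:FX\to X$ and a left $F$-comodule structure $l:X\to FX$ such that: (a) $\tau_{F,X}$ is left monadic and natural with respect to $\nu$, i.e. $\tau_{F,X}(F\times\nu)=(\nu\times F)(F\times\tau_{F,X})(\tau_{F,F}\times X)$; (b) $\tau_{X,F}$ is left comonadic and natural with respect to $l$, i.e. $(F\times l)\tau_{X,F}=(\tau_{F,F}\times X)(F\times\tau_{X,F})(l\times F)$; (c) $\tau_{F,X}$ is right comonadic and natural with respect to $l$, i.e. $(l\times F)\tau_{F,X}=(F\times\tau_{F,X})(\tau_{F,F}\times X)(F\times l)$; (d) $\tau_{X,F}$ is right monadic and natural with respect to $\nu$, i.e. $\tau_{X,F}(\nu\times F)=(F\times\nu)(\tau_{F,F}\times X)(F\times\tau_{X,F})$; (e) $(F\times\tau_{F,X})(\tau_{F,F}\times X)(F\times\tau_{X,F})=(\tau_{X,F}\times F)(X\times\tau_{F,F})(\tau_{F,X}\times F)$. Put $\psi_{F,X}=(\nu\times F)(F\times\tau_{F,X})(\Delta\times X)$ and $\phi_{X,F}=(\mu\times X)(F\times\tau_{X,F})(l\times F)$. If $(X,\psi_{F,X},\phi_{X,F})$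 is a Yetter–Drinfel'd module in $\mathcal K$, then it is a strong Yetter–Drinfel'd module.
   Context: Conventions: 1-cells are composed by juxtaposition, $\times$ is horizontal and $\circ$ (or juxtaposition) vertical composition of 2-cells; a 1-cell in a formula stands for its identity 2-cell. $\mathrm{Mnd}(\mathcal K)(F)$, for a monad $F$: pairs $(X,\psi:FX\to XF)$ with $\psi(\mu\times X)=(X\times\mu)(\psi\times F)(F\times\psi)$, $\psi(\eta\times X)=X\times\eta$. $\mathrm{Comnd}(\mathcal K)(F)$, for a comonad $F$: pairs $(X,\phi:XF\to FX)$ with $(\Delta\times X)\phi=(F\times\phi)(\phi\times F)(X\times\Delta)$, $(\varepsilon\times X)\phi=X\times\varepsilon$. Terminology: $\tau:FX\to XF$ is left monadic if $(X,\tau)\in\mathrm{Mnd}(\mathcal K)(F)$, and right comonadic if $(X\times\Delta)\tau=(\tau\times F)(F\times\tau)(\Delta\times X)$, $(X\times\varepsilon)\tau=\varepsilon\times X$; $\tau:XF\to FX$ is left comonadic if $(X,\tau)\in\mathrm{Comnd}(\mathcal K)(F)$, and right monadic if $\tau(X\times\mu)=(\mu\times X)(F\times\tau)(\tau\times F)$, $\tau(X\times\eta)=\eta\times X$. For $X=F$ all four notions apply to $\tau_{F,F}$. A (left) bimonad $(\mathcal A,F,\mu,\eta,\Delta,\varepsilon,\lambda)$: $(F,\mu,\eta)$ a monad, $(F,\Delta,\varepsilon)$ a comonad, $\lambda:FF\to FF$ with $(F,\lambda)\in\mathrm{Mnd}(\mathcal K)(F)$ and $(F,\lambda)\in\mathrm{Comnd}(\mathcal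 K)(F)$, and $\Delta\mu=(F\times\mu)(\lambda\times F)(F\times\Delta)$, $\varepsilon\mu=\varepsilon\times\varepsilon$, $\Delta\eta=\eta\times\eta$, $\varepsilon\eta=\mathrm{Id}$. A Yetter–Drinfel'd module over $F$ is $(X,\psi,\phi)$ with $(X,\psi)\in\mathrm{Mnd}(\mathcal K)(F)$, $(X,\phi)\in\mathrm{Comnd}(\mathcal K)(F)$ and $(F\times X\times\varepsilon)(\phi\times F)(X\times\lambda)(\psi\times\eta)=(F\times\nu)(\lambda\times X)(F\times l)$, where $\nu=(X\times\varepsilon)\psi$, $l=\phi(X\times\eta)$. It is strong if $(\phi\times F)(X\times\lambda)(\psi\times F)=(F\times\psi)(\lambda\times X)(F\times\phi)$. *)

theory Defs
  imports Main
begin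

text \<open>
  Strict 2-categories with explicit carriers.  \<open>G \<odot> F\<close> is the juxtaposition \<open>GF\<close> of 1-cells
  (first \<open>F\<close>, then \<open>G\<close>), \<open>\<beta> \<cdot> \<alpha>\<close> is vertical composition (first \<open>\<alpha>\<close>, then \<open>\<beta>\<close>),
  \<open>\<beta> \<star> \<alpha>\<close> is the horizontal composite \<open>\<beta> \<times> \<alpha>\<close>, and \<open>\<langle>F\<rangle>\<close> is the identity 2-cell of \<open>F\<close>.
  Composites are only meaningful for composable cells.
\<close>

record ('o, 'c, 't) two_cat =
  Obj :: "'o set"
  Cells1 :: "'c set"
  Cells2 :: "'t set"
  src :: "'c \<Rightarrow> 'o"
  trg :: "'c \<Rightarrow> 'o"
  dom2 :: "'t \<Rightarrow> 'c"
  cod2 :: "'t \<Rightarrow> 'c"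
  id1 :: "'o \<Rightarrow> 'c"
  comp1 :: "'c \<Rightarrow> 'c \<Rightarrow> 'c" (infixl \<open>\<odot>\<index>\<close> 75)
  id2 :: "'c \<Rightarrow> 't" (\<open>\<langle>_\<rangle>\<index>\<close>)
  vcomp :: "'t \<Rightarrow> 't \<Rightarrow> 't" (infixl \<open>\<cdot>\<index>\<close> 65)
  hcomp :: "'t \<Rightarrow> 't \<Rightarrow> 't" (infixl \<open>\<star>\<index>\<close> 70)

definition one_cell :: "('o, 'c, 't, 'm) two_cat_scheme \<Rightarrow> 'o \<Rightarrow> 'o \<Rightarrow> 'c \<Rightarrow> bool"
  where "one_cell K A B F \<longleftrightarrow> F \<in> Cells1 K \<and> src K F = A \<and> trg K F = B"

definition two_cell :: "('o, 'c, 't, 'm) two_cat_scheme \<Rightarrow> 'c \<Rightarrow> 'c \<Rightarrow> 't \<Rightarrow> bool"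
  where "two_cell K F G \<alpha> \<longleftrightarrow> \<alpha> \<in> Cells2 K \<and> dom2 K \<alpha> = F \<and> cod2 K \<alpha> = G"

locale two_category =
  fixes K :: "('o, 'c, 't, 'm) two_cat_scheme" (structure)
  assumes src_in: "F \<in> Cells1 K \<Longrightarrow> src K F \<in> Obj K"
    and trg_in: "F \<in> Cells1 K \<Longrightarrow> trg K F \<in> Obj K"
    and id1_cell: "A \<in> Obj K \<Longrightarrow> one_cell K A A (id1 K A)"
    and comp1_cell:
      "\<lbrakk>one_cell K A B F; one_cell K B C G\<rbrakk> \<Longrightarrow> one_cell K A C (G \<odot> F)"
    and comp1_assoc:
      "\<lbrakk>one_cell K A B F; one_cell K B C G; one_cell K C D H\<rbrakk>
        \<Longrightarrow> H \<odot> G \<odot> F = H \<odot> (G \<odot> F)"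
    and comp1_id_left: "one_cell K A B F \<Longrightarrow> id1 K B \<odot> F = F"
    and comp1_id_right: "one_cell K A B F \<Longrightarrow> F \<odot> id1 K A = F"
    and dom2_in: "\<alpha> \<in> Cells2 K \<Longrightarrow> dom2 K \<alpha> \<in> Cells1 K"
    and cod2_in: "\<alpha> \<in> Cells2 K \<Longrightarrow> cod2 K \<alpha> \<in> Cells1 K"
    and src_parallel: "\<alpha> \<in> Cells2 K \<Longrightarrow> src K (dom2 K \<alpha>) = src K (cod2 K \<alpha>)"
    and trg_parallel: "\<alpha> \<in> Cells2 K \<Longrightarrow> trg K (dom2 K \<alpha>) = trg K (cod2 K \<alpha>)"
    and id2_cell: "F \<in> Cells1 K \<Longrightarrow> two_cell K F F \<langle>F\<rangle>"
    and vcomp_cell: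
      "\<lbrakk>two_cell K F G \<alpha>; two_cell K G H \<beta>\<rbrakk> \<Longrightarrow> two_cell K F H (\<beta> \<cdot> \<alpha>)"
    and vcomp_assoc:
      "\<lbrakk>two_cell K F G \<alpha>; two_cell K G H \<beta>; two_cell K H L \<gamma>\<rbrakk>
        \<Longrightarrow> \<gamma> \<cdot> \<beta> \<cdot> \<alpha> = \<gamma> \<cdot> (\<beta> \<cdot> \<alpha>)"
    and vcomp_id_left: "two_cell K F G \<alpha> \<Longrightarrow> \<langle>G\<rangle> \<cdot> \<alpha> = \<alpha>"
    and vcomp_id_right: "two_cell K F G \<alpha> \<Longrightarrow> \<alpha> \<cdot> \<langle>F\<rangle> = \<alpha>"
    and hcomp_cell:
      "\<lbrakk>two_cell K F F' \<alpha>; two_cell K G G' \<beta>; src K G = trg K F\<rbrakk>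
        \<Longrightarrow> two_cell K (G \<odot> F) (G' \<odot> F') (\<beta> \<star> \<alpha>)"
    and hcomp_assoc:
      "\<lbrakk>two_cell K F F' \<alpha>; two_cell K G G' \<beta>; two_cell K H H' \<gamma>;
        src K G = trg K F; src K H = trg K G\<rbrakk>
        \<Longrightarrow> \<gamma> \<star> \<beta> \<star> \<alpha> = \<gamma> \<star> (\<beta> \<star> \<alpha>)"
    and hcomp_id_left: "two_cell K F G \<alpha> \<Longrightarrow> \<langle>id1 K (trg K F)\<rangle> \<star> \<alpha> = \<alpha>"
    and hcomp_id_right: "two_cell K F G \<alpha> \<Longrightarrow> \<alpha> \<star> \<langle>id1 K (src K F)\<rangle> = \<alpha>"
    and hcomp_id2:
      "\<lbrakk>F \<in> Cells1 K; G \<in> Cells1 K; src K G = trg K F\<rbrakk> \<Longrightarrow> \<langle>G\<rangle> \<star> \<langle>F\<rangle> = \<langle>G \<odot> F\<rangle>"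
    and interchange:
      "\<lbrakk>two_cell K F F' \<alpha>; two_cell K F' F'' \<alpha>'; two_cell K G G' \<beta>; two_cell K G' G'' \<beta>';
        src K G = trg K F\<rbrakk>
        \<Longrightarrow> (\<beta>' \<cdot> \<beta>) \<star> (\<alpha>' \<cdot> \<alpha>) = (\<beta>' \<star> \<alpha>') \<cdot> (\<beta> \<star> \<alpha>)"

definition monad :: "('o, 'c, 't, 'm) two_cat_scheme \<Rightarrow> 'o \<Rightarrow> 'c \<Rightarrow> 't \<Rightarrow> 't \<Rightarrow> bool"
  where "monad K A F \<mu> \<eta> \<longleftrightarrow>
    one_cell K A A F \<and>
    two_cell K (F \<odot> F) F \<mu> \<and>
    two_cell K (id1 K A) F \<eta> \<and>
    \<mu> \<cdot> (\<mu> \<star> \<langle>F\<rangle>) = \<mu> \<cdot> (\<langle>F\<rangle> \<star> \<mu>) \<and>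
    \<mu> \<cdot> (\<eta> \<star> \<langle>F\<rangle>) = \<langle>F\<rangle> \<and>
    \<mu> \<cdot> (\<langle>F\<rangle> \<star> \<eta>) = \<langle>F\<rangle>"
  for K (structure)

definition comonad :: "('o, 'c, 't, 'm) two_cat_scheme \<Rightarrow> 'o \<Rightarrow> 'c \<Rightarrow> 't \<Rightarrow> 't \<Rightarrow> bool"
  where "comonad K A F \<Delta> \<epsilon> \<longleftrightarrow>
    one_cell K A A F \<and>
    two_cell K F (F \<odot> F) \<Delta> \<and>
    two_cell K F (id1 K A) \<epsilon> \<and>
    (\<Delta> \<star> \<langle>F\<rangle>) \<cdot> \<Delta> = (\<langle>F\<rangle> \<star> \<Delta>) \<cdot> \<Delta> \<and>
    (\<epsilon> \<star> \<langle>F\<rangle>) \<cdot> \<Delta> = \<langle>F\<rangle> \<and>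
    (\<langle>F\<rangle> \<star> \<epsilon>) \<cdot> \<Delta> = \<langle>F\<rangle>"
  for K (structure)

definition Mnd :: "('o, 'c, 't, 'm) two_cat_scheme \<Rightarrow> 'o \<Rightarrow> 'c \<Rightarrow> 't \<Rightarrow> 't \<Rightarrow> ('c \<times> 't) set"
  where "Mnd K A F \<mu> \<eta> = {(X, \<psi>).
    one_cell K A A X \<and>
    two_cell K (F \<odot> X) (X \<odot> F) \<psi> \<and>
    \<psi> \<cdot> (\<mu> \<star> \<langle>X\<rangle>) = (\<langle>X\<rangle> \<star> \<mu>) \<cdot> (\<psi> \<star> \<langle>F\<rangle>) \<cdot> (\<langle>F\<rangle> \<star> \<psi>) \<and>
    \<psi> \<cdot> (\<eta> \<star> \<langle>X\<rangle>) = \<langle>X\<rangle> \<star> \<eta>}"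
  for K (structure)

definition Comnd :: "('o, 'c, 't, 'm) two_cat_scheme \<Rightarrow> 'o \<Rightarrow> 'c \<Rightarrow> 't \<Rightarrow> 't \<Rightarrow> ('c \<times> 't) set"
  where "Comnd K A F \<Delta> \<epsilon> = {(X, \<phi>).
    one_cell K A A X \<and>
    two_cell K (X \<odot> F) (F \<odot> X) \<phi> \<and>
    (\<Delta> \<star> \<langle>X\<rangle>) \<cdot> \<phi> = (\<langle>F\<rangle> \<star> \<phi>) \<cdot> (\<phi> \<star> \<langle>F\<rangle>) \<cdot> (\<langle>X\<rangle> \<star> \<Delta>) \<and>
    (\<epsilon> \<star> \<langle>X\<rangle>) \<cdot> \<phi> = \<langle>X\<rangle> \<star> \<epsilon>}"
  for K (structure)

definition left_monadic ::
    "('o, 'c, 't, 'm) two_cat_scheme \<Rightarrow> 'o \<Rightarrow> 'c \<Rightarrow> 't \<Rightarrow> 't \<Rightarrow> 'c \<Rightarrow> 't \<Rightarrow> bool"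
  where "left_monadic K A F \<mu> \<eta> X \<tau> \<longleftrightarrow> (X, \<tau>) \<in> Mnd K A F \<mu> \<eta>"

definition right_comonadic ::
    "('o, 'c, 't, 'm) two_cat_scheme \<Rightarrow> 'o \<Rightarrow> 'c \<Rightarrow> 't \<Rightarrow> 't \<Rightarrow> 'c \<Rightarrow> 't \<Rightarrow> bool"
  where "right_comonadic K A F \<Delta> \<epsilon> X \<tau> \<longleftrightarrow>
    one_cell K A A X \<and>
    two_cell K (F \<odot> X) (X \<odot> F) \<tau> \<and>
    (\<langle>X\<rangle> \<star> \<Delta>) \<cdot> \<tau> = (\<tau> \<star> \<langle>F\<rangle>) \<cdot> (\<langle>F\<rangle> \<star> \<tau>) \<cdot> (\<Delta> \<star> \<langle>X\<rangle>) \<and>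
    (\<langle>X\<rangle> \<star> \<epsilon>) \<cdot> \<tau> = \<epsilon> \<star> \<langle>X\<rangle>"
  for K (structure)

definition left_comonadic ::
    "('o, 'c, 't, 'm) two_cat_scheme \<Rightarrow> 'o \<Rightarrow> 'c \<Rightarrow> 't \<Rightarrow> 't \<Rightarrow> 'c \<Rightarrow> 't \<Rightarrow> bool"
  where "left_comonadic K A F \<Delta> \<epsilon> X \<tau> \<longleftrightarrow> (X, \<tau>) \<in> Comnd K A F \<Delta> \<epsilon>"

definition right_monadic ::
    "('o, 'c, 't, 'm) two_cat_scheme \<Rightarrow> 'o \<Rightarrow> 'c \<Rightarrow> 't \<Rightarrow> 't \<Rightarrow> 'c \<Rightarrow> 't \<Rightarrow> bool"
  where "right_monadic K A F \<mu> \<eta> X \<tau> \<longleftrightarrow>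
    one_cell K A A X \<and>
    two_cell K (X \<odot> F) (F \<odot> X) \<tau> \<and>
    \<tau> \<cdot> (\<langle>X\<rangle> \<star> \<mu>) = (\<mu> \<star> \<langle>X\<rangle>) \<cdot> (\<langle>F\<rangle> \<star> \<tau>) \<cdot> (\<tau> \<star> \<langle>F\<rangle>) \<and>
    \<tau> \<cdot> (\<langle>X\<rangle> \<star> \<eta>) = \<eta> \<star> \<langle>X\<rangle>"
  for K (structure)

definition bimonad ::
    "('o, 'c, 't, 'm) two_cat_scheme \<Rightarrow> 'o \<Rightarrow> 'c \<Rightarrow> 't \<Rightarrow> 't \<Rightarrow> 't \<Rightarrow> 't \<Rightarrow> 't \<Rightarrow> bool"
  where "bimonad K A F \<mu> \<eta> \<Delta> \<epsilon> lam \<longleftrightarrow>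
    monad K A F \<mu> \<eta> \<and>
    comonad K A F \<Delta> \<epsilon> \<and>
    (F, lam) \<in> Mnd K A F \<mu> \<eta> \<and>
    (F, lam) \<in> Comnd K A F \<Delta> \<epsilon> \<and>
    \<Delta> \<cdot> \<mu> = (\<langle>F\<rangle> \<star> \<mu>) \<cdot> (lam \<star> \<langle>F\<rangle>) \<cdot> (\<langle>F\<rangle> \<star> \<Delta>) \<and>
    \<epsilon> \<cdot> \<mu> = \<epsilon> \<star> \<epsilon> \<and>
    \<Delta> \<cdot> \<eta> = \<eta> \<star> \<eta> \<and>
    \<epsilon> \<cdot> \<eta> = \<langle>id1 K A\<rangle>"
  for K (structure)

definition left_module ::
    "('o, 'c, 't, 'm) two_cat_scheme \<Rightarrow> 'o \<Rightarrow> 'c \<Rightarrow> 't \<Rightarrow> 't \<Rightarrow> 'c \<Rightarrow> 't \<Rightarrow> bool"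
  where "left_module K A F \<mu> \<eta> X \<nu> \<longleftrightarrow>
    one_cell K A A X \<and>
    two_cell K (F \<odot> X) X \<nu> \<and>
    \<nu> \<cdot> (\<mu> \<star> \<langle>X\<rangle>) = \<nu> \<cdot> (\<langle>F\<rangle> \<star> \<nu>) \<and>
    \<nu> \<cdot> (\<eta> \<star> \<langle>X\<rangle>) = \<langle>X\<rangle>"
  for K (structure)

definition left_comodule ::
    "('o, 'c, 't, 'm) two_cat_scheme \<Rightarrow> 'o \<Rightarrow> 'c \<Rightarrow> 't \<Rightarrow> 't \<Rightarrow> 'c \<Rightarrow> 't \<Rightarrow> bool"
  where "left_comodule K A F \<Delta> \<epsilon> X l \<longleftrightarrow>
    one_cell K A A X \<and>
    two_cell K X (F \<odot> X) l \<and>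
    (\<Delta> \<star> \<langle>X\<rangle>) \<cdot> l = (\<langle>F\<rangle> \<star> l) \<cdot> l \<and>
    (\<epsilon> \<star> \<langle>X\<rangle>) \<cdot> l = \<langle>X\<rangle>"
  for K (structure)

definition yetter_drinfeld ::
    "('o, 'c, 't, 'm) two_cat_scheme \<Rightarrow> 'o \<Rightarrow> 'c \<Rightarrow> 't \<Rightarrow> 't \<Rightarrow> 't \<Rightarrow> 't \<Rightarrow> 't
      \<Rightarrow> 'c \<Rightarrow> 't \<Rightarrow> 't \<Rightarrow> bool"
  where "yetter_drinfeld K A F \<mu> \<eta> \<Delta> \<epsilon> lam X \<psi> \<phi> \<longleftrightarrow>
    (X, \<psi>) \<in> Mnd K A F \<mu> \<eta> \<and>
    (X, \<phi>) \<in> Comnd K A F \<Delta> \<epsilon> \<and>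
    (let \<nu> = (\<langle>X\<rangle> \<star> \<epsilon>) \<cdot> \<psi>; l = \<phi> \<cdot> (\<langle>X\<rangle> \<star> \<eta>) in
      (\<langle>F\<rangle> \<star> \<langle>X\<rangle> \<star> \<epsilon>) \<cdot> (\<phi> \<star> \<langle>F\<rangle>) \<cdot> (\<langle>X\<rangle> \<star> lam) \<cdot> (\<psi> \<star> \<eta>) =
      (\<langle>F\<rangle> \<star> \<nu>) \<cdot> (lam \<star> \<langle>X\<rangle>) \<cdot> (\<langle>F\<rangle> \<star> l))"
  for K (structure)

definition strong_yetter_drinfeld ::
    "('o, 'c, 't, 'm) two_cat_scheme \<Rightarrow> 'o \<Rightarrow> 'c \<Rightarrow> 't \<Rightarrow> 't \<Rightarrow> 't \<Rightarrow> 't \<Rightarrow> 't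
      \<Rightarrow> 'c \<Rightarrow> 't \<Rightarrow> 't \<Rightarrow> bool"
  where "strong_yetter_drinfeld K A F \<mu> \<eta> \<Delta> \<epsilon> lam X \<psi> \<phi> \<longleftrightarrow>
    yetter_drinfeld K A F \<mu> \<eta> \<Delta> \<epsilon> lam X \<psi> \<phi> \<and>
    (\<phi> \<star> \<langle>F\<rangle>) \<cdot> (\<langle>X\<rangle> \<star> lam) \<cdot> (\<psi> \<star> \<langle>F\<rangle>) =
    (\<langle>F\<rangle> \<star> \<psi>) \<cdot> (lam \<star> \<langle>X\<rangle>) \<cdot> (\<langle>F\<rangle> \<star> \<phi>)"
  for K (structure)

end

theory Submission
  imports Defs
begin

text \<open>
  Write \<open>\<sigma>\<close>, \<open>\<rho>\<close> for \<open>\<tau>\<^sub>F\<^sub>X\<close>, \<open>\<tau>\<^sub>X\<^sub>F\<close>.  Since \<open>(X \<star> \<epsilon>) \<cdot> \<psi> = \<nu>\<close> and \<open>\<phi> \<cdot> (X \<star> \<eta>) = l\<close>, the Yetter-Drinfel'd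
  condition collapses to \<open>\<phi> \<cdot> \<psi> = (F \<star> \<nu>) \<cdot> (\<lambda> \<star> X) \<cdot> (F \<star> l)\<close>.  Substituting the formula for \<open>\<lambda>\<close> into
  \<open>(\<phi> \<star> F) \<cdot> (X \<star> \<lambda>) \<cdot> (\<psi> \<star> F)\<close>, the multiplication passes through \<open>\<phi>\<close> and the comultiplication
  through \<open>\<psi>\<close>, which brings the two together as \<open>\<phi> \<cdot> \<psi>\<close>.  After inserting the condition,
  naturality (c), (d) and the Yang-Baxter equation (e) move all occurrences of \<open>\<nu>\<close>, \<open>l\<close>, \<open>\<sigma>\<close>, \<open>\<rho>\<close>
  to the outside.  What remains in the middle is a 2-cell \<open>FFF \<Rightarrow> FFF\<close> that equals
  \<open>(F \<star> \<Delta>) \<cdot> \<lambda> \<cdot> (F \<star> \<mu>)\<close>, because \<open>\<tau>\<^sub>F\<^sub>F\<close> is right monadic and right comonadic.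
\<close>

section \<open>Calculus of 2-cells between endo-1-cells of one 0-cell\<close>

locale endo_cells = two_category K for K :: "('o, 'c, 't, 'm) two_cat_scheme" (structure) +
  fixes A :: 'o
  assumes A_in: "A \<in> Obj K"
begin

text \<open>Any two endo-1-cells of \<open>A\<close> are composable, so horizontal composition loses
  its source and target side conditions: one works in a strict monoidal category.\<close>

definition ob :: "'c \<Rightarrow> bool" where "ob F \<longleftrightarrow> one_cell K A A F"
definition cell :: "'t \<Rightarrow> bool"
  where "cell \<alpha> \<longleftrightarrow> \<alpha> \<in> Cells2 K \<and> ob (dom2 K \<alpha>) \<and> ob (cod2 K \<alpha>)"
text \<open>A predicate rather than a syntactic form: \<open>id2_comp1\<close> splits the identity
  of a composite 1-cell, so an identity whisker may be a product of several identities.\<close>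

definition is_id :: "'t \<Rightarrow> bool"
  where "is_id \<alpha> \<longleftrightarrow> (\<exists>F. ob F \<and> \<alpha> = \<langle>F\<rangle>)"

definition seq :: "'t \<Rightarrow> 't \<Rightarrow> bool"
  where "seq \<beta> \<alpha> \<longleftrightarrow> cell \<beta> \<and> cell \<alpha> \<and> cod2 K \<alpha> = dom2 K \<beta>"

text \<open>A synonym of \<open>cell\<close> that the simplifier is never taught to prove for vertical composites.
  It forces sequentiality of composites to be reduced to that of neighbouring factors; unfolding
  \<open>cell\<close>, \<open>dom2\<close> and \<open>cod2\<close> recursively would make typing exponential in the size of a diagram.\<close>

definition layer :: "'t \<Rightarrow> bool"
  where "layer \<alpha> \<longleftrightarrow> cell \<alpha>"

lemma cell_two: "cell \<alpha> \<Longrightarrow> two_cell K (dom2 K \<alpha>) (cod2 K \<alpha>) \<alpha>"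
  by (simp add: cell_def two_cell_def)

lemma ob_src_trg: "ob F \<Longrightarrow> src K F = A \<and> trg K F = A \<and> F \<in> Cells1 K"
  by (simp add: ob_def one_cell_def)

lemma cellI: "two_cell K F G \<alpha> \<Longrightarrow> ob F \<Longrightarrow> ob G \<Longrightarrow> cell \<alpha> \<and> dom2 K \<alpha> = F \<and> cod2 K \<alpha> = G"
  by (auto simp add: cell_def two_cell_def)

lemma cell_ob [simp]: "cell \<alpha> \<Longrightarrow> ob (dom2 K \<alpha>)" "cell \<alpha> \<Longrightarrow> ob (cod2 K \<alpha>)"
  by (simp_all add: cell_def)

lemma ob_id1 [simp]: "ob (id1 K A)"
  using id1_cell A_in by (simp add: ob_def)

lemma ob_comp1 [simp]: "ob F \<Longrightarrow> ob G \<Longrightarrow> ob (G \<odot> F)"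
  using comp1_cell by (auto simp: ob_def)

lemma ob_assoc [simp]: "ob F \<Longrightarrow> ob G \<Longrightarrow> ob H \<Longrightarrow> H \<odot> G \<odot> F = H \<odot> (G \<odot> F)"
  using comp1_assoc by (auto simp: ob_def)

lemma ob_unit [simp]: "ob F \<Longrightarrow> id1 K A \<odot> F = F" "ob F \<Longrightarrow> F \<odot> id1 K A = F"
  using comp1_id_left comp1_id_right by (auto simp: ob_def)

lemma id2_simps [simp]:
  assumes "ob F" shows "layer \<langle>F\<rangle>" "cell \<langle>F\<rangle>" "dom2 K \<langle>F\<rangle> = F" "cod2 K \<langle>F\<rangle> = F" "is_id \<langle>F\<rangle>"
  using cellI[OF id2_cell] ob_src_trg assms by (auto simp: is_id_def layer_def)

lemma vcomp_simps [simp]: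
  assumes "seq \<beta> \<alpha>"
  shows "cell (\<beta> \<cdot> \<alpha>)" "dom2 K (\<beta> \<cdot> \<alpha>) = dom2 K \<alpha>" "cod2 K (\<beta> \<cdot> \<alpha>) = cod2 K \<beta>"
  using cellI[OF vcomp_cell] assms cell_two cell_ob unfolding seq_def by metis+

lemma layer_cell [simp]: "layer \<alpha> \<Longrightarrow> cell \<alpha>"
  by (simp add: layer_def)

lemma seq_layer [simp]: "layer \<alpha> \<Longrightarrow> layer \<beta> \<Longrightarrow> cod2 K \<alpha> = dom2 K \<beta> \<Longrightarrow> seq \<beta> \<alpha>"
  by (simp add: seq_def)

lemma seq_vcomp [simp]:
  "seq \<gamma> \<beta> \<Longrightarrow> seq \<beta> \<alpha> \<Longrightarrow> seq (\<gamma> \<cdot> \<beta>) \<alpha>"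
  "seq \<gamma> \<beta> \<Longrightarrow> seq \<beta> \<alpha> \<Longrightarrow> seq \<gamma> (\<beta> \<cdot> \<alpha>)"
  by (metis seq_def vcomp_simps)+

lemma hcomp_simps [simp]:
  assumes "cell \<alpha>" "cell \<beta>"
  shows "layer (\<beta> \<star> \<alpha>)" "cell (\<beta> \<star> \<alpha>)" "dom2 K (\<beta> \<star> \<alpha>) = dom2 K \<beta> \<odot> dom2 K \<alpha>"
    "cod2 K (\<beta> \<star> \<alpha>) = cod2 K \<beta> \<odot> cod2 K \<alpha>"
  using cellI[OF hcomp_cell[OF cell_two[OF assms(1)] cell_two[OF assms(2)]]] assms ob_src_trg
  by (auto simp: layer_def)

lemma vassoc [simp]: "seq \<gamma> \<beta> \<Longrightarrow> seq \<beta> \<alpha> \<Longrightarrow> \<gamma> \<cdot> \<beta> \<cdot> \<alpha> = \<gamma> \<cdot> (\<beta> \<cdot> \<alpha>)"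
  unfolding seq_def using vcomp_assoc cell_two by metis

lemma hassoc [simp]:
  "cell \<alpha> \<Longrightarrow> cell \<beta> \<Longrightarrow> cell \<gamma> \<Longrightarrow> \<gamma> \<star> \<beta> \<star> \<alpha> = \<gamma> \<star> (\<beta> \<star> \<alpha>)"
  using hcomp_assoc cell_two cell_ob ob_src_trg by metis

text \<open>The orientation fixes a normal form: together with \<open>hassoc\<close>, a layer
  becomes a right-nested product in which every idle strand appears as its own identity
  factor.\<close>

lemma id2_comp1 [simp]: "ob F \<Longrightarrow> ob G \<Longrightarrow> \<langle>G \<odot> F\<rangle> = \<langle>G\<rangle> \<star> \<langle>F\<rangle>"
  using hcomp_id2 ob_src_trg by metis

lemma is_id_hcomp [simp]: "is_id \<alpha> \<Longrightarrow> is_id \<beta> \<Longrightarrow> is_id (\<beta> \<star> \<alpha>)"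
  unfolding is_id_def using id2_comp1 ob_comp1 by metis

lemma vcomp_is_id:
  assumes "is_id c"
  shows "seq c \<alpha> \<Longrightarrow> c \<cdot> \<alpha> = \<alpha>" "seq \<alpha> c \<Longrightarrow> \<alpha> \<cdot> c = \<alpha>"
  using assms vcomp_id_left vcomp_id_right cell_two id2_simps unfolding is_id_def seq_def by metis+

text \<open>Stated for the two shapes of identity layers only: with \<open>vcomp_is_id\<close> as a simp rule, every
  composite would be tested for being an identity, again at exponential cost.\<close>

lemma vcomp_id2 [simp]:
  assumes "ob F"
  shows "seq \<langle>F\<rangle> \<alpha> \<Longrightarrow> \<langle>F\<rangle> \<cdot> \<alpha> = \<alpha>" "seq \<alpha> \<langle>F\<rangle> \<Longrightarrow> \<alpha> \<cdot> \<langle>F\<rangle> = \<alpha>"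
    "is_id c \<Longrightarrow> seq (\<langle>F\<rangle> \<star> c) \<alpha> \<Longrightarrow> \<langle>F\<rangle> \<star> c \<cdot> \<alpha> = \<alpha>"
    "is_id c \<Longrightarrow> seq \<alpha> (\<langle>F\<rangle> \<star> c) \<Longrightarrow> \<alpha> \<cdot> (\<langle>F\<rangle> \<star> c) = \<alpha>"
  using assms by (simp_all add: vcomp_is_id)

lemma hcomp_unit [simp]: "cell \<alpha> \<Longrightarrow> \<langle>id1 K A\<rangle> \<star> \<alpha> = \<alpha>" "cell \<alpha> \<Longrightarrow> \<alpha> \<star> \<langle>id1 K A\<rangle> = \<alpha>"
  using hcomp_id_left hcomp_id_right cell_two cell_ob ob_src_trg by metis+

lemma inter:
  "seq \<alpha>' \<alpha> \<Longrightarrow> seq \<beta>' \<beta> \<Longrightarrow> (\<beta>' \<cdot> \<beta>) \<star> (\<alpha>' \<cdot> \<alpha>) = (\<beta>' \<star> \<alpha>') \<cdot> (\<beta> \<star> \<alpha>)"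
  unfolding seq_def
  using interchange[of "dom2 K \<alpha>" "cod2 K \<alpha>" \<alpha> "cod2 K \<alpha>'" \<alpha>' "dom2 K \<beta>" "cod2 K \<beta>" \<beta> "cod2 K \<beta>'" \<beta>']
    cell_two ob_src_trg cell_ob by metis

text \<open>Instance of the interchange law with \<open>c = c \<cdot> c\<close>. The orientation
  distributes whiskers, so simp turns a diagram into a list of layers; two bracketings of the same
  list of layers are then proved equal by simp alone.\<close>

lemma whisker [simp]:
  assumes "is_id c" "seq \<beta> \<alpha>"
  shows "c \<star> (\<beta> \<cdot> \<alpha>) = (c \<star> \<beta>) \<cdot> (c \<star> \<alpha>)" "(\<beta> \<cdot> \<alpha>) \<star> c = (\<beta> \<star> c) \<cdot> (\<alpha> \<star> c)"
  using assms inter[of \<beta> \<alpha> c c] inter[of c c \<beta> \<alpha>] by (auto simp: is_id_def vcomp_is_id)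

text \<open>Both sides equal \<open>\<beta> \<star> \<alpha>\<close>. Neither order suits all
  diagrams, so this is no simp rule: each slide of one 2-cell past another on disjoint strands is
  invoked by hand.\<close>

lemma exchange:
  assumes "cell \<alpha>" "cell \<beta>"
  shows "(\<langle>cod2 K \<beta>\<rangle> \<star> \<alpha>) \<cdot> (\<beta> \<star> \<langle>dom2 K \<alpha>\<rangle>) = (\<beta> \<star> \<langle>cod2 K \<alpha>\<rangle>) \<cdot> (\<langle>dom2 K \<beta>\<rangle> \<star> \<alpha>)"
proof -
  \<comment> \<open>\<open>seq_layer\<close> derives sequentiality from \<open>layer\<close>, so the
    two cells are presented in that form.\<close>
  note [simp] = assms[folded layer_def]
  have "(\<langle>cod2 K \<beta>\<rangle> \<star> \<alpha>) \<cdot> (\<beta> \<star> \<langle>dom2 K \<alpha>\<rangle>) = \<beta> \<star> \<alpha>"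
    using inter[of \<alpha> "\<langle>dom2 K \<alpha>\<rangle>" "\<langle>cod2 K \<beta>\<rangle>" \<beta>] by simp
  also have "\<dots> = (\<beta> \<star> \<langle>cod2 K \<alpha>\<rangle>) \<cdot> (\<langle>dom2 K \<beta>\<rangle> \<star> \<alpha>)"
    using inter[of "\<langle>cod2 K \<alpha>\<rangle>" \<alpha> \<beta> "\<langle>dom2 K \<beta>\<rangle>"] by simp
  finally show ?thesis .
qed

end

section \<open>The bimonad and its 2-cell \<lambda> built from \<tau>\<close>

locale braided_bimonad = endo_cells K A for K :: "('o, 'c, 't, 'm) two_cat_scheme" (structure) and A +
  fixes F :: 'c and \<mu> \<eta> \<Delta> \<epsilon> \<tau> lam :: 't
  assumes monad_F: "monad K A F \<mu> \<eta>"
    and comonad_F: "comonad K A F \<Delta> \<epsilon>"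
    and tau_right_monadic: "right_monadic K A F \<mu> \<eta> F \<tau>"
    and tau_right_comonadic: "right_comonadic K A F \<Delta> \<epsilon> F \<tau>"
    and lam_eq: "lam = (\<mu> \<star> \<langle>F\<rangle>) \<cdot> (\<langle>F\<rangle> \<star> \<tau>) \<cdot> (\<Delta> \<star> \<langle>F\<rangle>)"
begin

abbreviation f :: 't where "f \<equiv> \<langle>F\<rangle>"

lemma F_ob [simp]: "ob F"
  using monad_F by (simp add: monad_def ob_def)

lemma F_cells [simp]:
  "layer \<mu>" "dom2 K \<mu> = F \<odot> F" "cod2 K \<mu> = F"
  "layer \<eta>" "dom2 K \<eta> = id1 K A" "cod2 K \<eta> = F"
  "layer \<Delta>" "dom2 K \<Delta> = F" "cod2 K \<Delta> = F \<odot> F"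
  "layer \<epsilon>" "dom2 K \<epsilon> = F" "cod2 K \<epsilon> = id1 K A"
  "layer \<tau>" "dom2 K \<tau> = F \<odot> F" "cod2 K \<tau> = F \<odot> F"
  using monad_F comonad_F tau_right_monadic
    cellI[of "F \<odot> F" F \<mu>] cellI[of "id1 K A" F \<eta>] cellI[of F "F \<odot> F" \<Delta>]
    cellI[of F "id1 K A" \<epsilon>] cellI[of "F \<odot> F" "F \<odot> F" \<tau>]
  by (simp_all add: layer_def monad_def comonad_def right_monadic_def)

lemma lam_cell [simp]: "layer lam" "dom2 K lam = F \<odot> F" "cod2 K lam = F \<odot> F"
  unfolding layer_def lam_eq by simp_all

lemma mu_assoc: "\<mu> \<cdot> (f \<star> \<mu>) = \<mu> \<cdot> (\<mu> \<star> f)"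
  using monad_F by (simp add: monad_def)

lemma Delta_coassoc: "(f \<star> \<Delta>) \<cdot> \<Delta> = (\<Delta> \<star> f) \<cdot> \<Delta>"
  using comonad_F by (simp add: comonad_def)

lemma tau_mu: "\<tau> \<cdot> (f \<star> \<mu>) = (\<mu> \<star> f) \<cdot> ((f \<star> \<tau>) \<cdot> (\<tau> \<star> f))"
  using tau_right_monadic by (simp add: right_monadic_def)

lemma Delta_tau: "(f \<star> \<Delta>) \<cdot> \<tau> = (\<tau> \<star> f) \<cdot> ((f \<star> \<tau>) \<cdot> (\<Delta> \<star> f))"
  using tau_right_comonadic by (simp add: right_comonadic_def)

text \<open>Right monadicity of \<tau> carries the unit across the strand to the multiplication
  inside \<lambda>, which absorbs it; the counit then reaches the comultiplication and cancels
  it.\<close>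

lemma lam_unit_counit: "(f \<star> \<epsilon>) \<cdot> (lam \<cdot> (f \<star> \<eta>)) = f"
proof -
  have 1: "\<tau> \<cdot> (f \<star> \<eta>) = \<eta> \<star> f" "(f \<star> \<epsilon>) \<cdot> \<Delta> = f" "\<mu> \<cdot> (f \<star> \<eta>) = f"
    using tau_right_monadic comonad_F monad_F
    by (simp_all add: right_monadic_def comonad_def monad_def)
  have "(f \<star> \<epsilon>) \<cdot> (lam \<cdot> (f \<star> \<eta>)) = (f \<star> \<epsilon>) \<cdot> (\<mu> \<star> f) \<cdot> (f \<star> \<tau>) \<cdot> ((\<Delta> \<star> f) \<cdot> (f \<star> \<eta>))"
    by (simp add: lam_eq)
  also have "(\<Delta> \<star> f) \<cdot> (f \<star> \<eta>) = (f \<star> f \<star> \<eta>) \<cdot> \<Delta>"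
    using exchange[of \<eta> \<Delta>] by simp
  also have "(f \<star> \<epsilon>) \<cdot> (\<mu> \<star> f) = \<mu> \<cdot> (f \<star> f \<star> \<epsilon>)"
    using exchange[of \<epsilon> \<mu>] by simp
  \<comment> \<open>Layers are regrouped under a common whisker so that the equations in
    \<open>1\<close> match; simp splits the group again afterwards.\<close>
  also have "\<mu> \<cdot> (f \<star> f \<star> \<epsilon>) \<cdot> (f \<star> \<tau>) \<cdot> ((f \<star> f \<star> \<eta>) \<cdot> \<Delta>) =
     \<mu> \<cdot> (f \<star> f \<star> \<epsilon>) \<cdot> (f \<star> (\<tau> \<cdot> (f \<star> \<eta>))) \<cdot> \<Delta>" by simp
  also have "\<dots> = \<mu> \<cdot> (f \<star> ((f \<star> \<epsilon>) \<cdot> (\<eta> \<star> f))) \<cdot> \<Delta>"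
    unfolding 1 by simp
  also have "\<dots> = \<mu> \<cdot> (f \<star> \<eta>) \<cdot> ((f \<star> \<epsilon>) \<cdot> \<Delta>)"
    using exchange[of \<epsilon> \<eta>] by simp
  finally show ?thesis by (simp add: 1)
qed

text \<open>Right monadicity replaces the crossing by two, one for each factor of the product. The
  comultiplication then passes both of these in turn, and right comonadicity doubles each, which
  gives four crossings.\<close>

lemma Delta_tau_mu:
  "(f \<star> \<Delta>) \<cdot> (\<tau> \<cdot> (f \<star> \<mu>)) =
    (\<mu> \<star> f \<star> f) \<cdot> (f \<star> \<tau> \<star> f) \<cdot> (f \<star> f \<star> \<tau>) \<cdot> (\<tau> \<star> f \<star> f) \<cdot> (f \<star> \<tau> \<star> f) \<cdot> (\<Delta> \<star> f \<star> f)"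
proof -
  have "(f \<star> \<Delta>) \<cdot> (\<tau> \<cdot> (f \<star> \<mu>)) = (f \<star> \<Delta>) \<cdot> (\<mu> \<star> f) \<cdot> (f \<star> \<tau>) \<cdot> (\<tau> \<star> f)"
    by (simp add: tau_mu)
  also have "(f \<star> \<Delta>) \<cdot> (\<mu> \<star> f) = (\<mu> \<star> f \<star> f) \<cdot> (f \<star> f \<star> \<Delta>)"
    using exchange[of \<Delta> \<mu>] by simp
  also have "\<dots> \<cdot> (f \<star> \<tau>) \<cdot> (\<tau> \<star> f) = (\<mu> \<star> f \<star> f) \<cdot> (f \<star> ((f \<star> \<Delta>) \<cdot> \<tau>)) \<cdot> (\<tau> \<star> f)"
    by simp
  also have "\<dots> = (\<mu> \<star> f \<star> f) \<cdot> (f \<star> ((\<tau> \<star> f) \<cdot> ((f \<star> \<tau>) \<cdot> (\<Delta> \<star> f)))) \<cdot> (\<tau> \<star> f)"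
    by (simp only: Delta_tau)
  also have "\<dots> = (\<mu> \<star> f \<star> f) \<cdot> (f \<star> \<tau> \<star> f) \<cdot> (f \<star> f \<star> \<tau>) \<cdot> (((f \<star> \<Delta>) \<cdot> \<tau>) \<star> f)"
    by simp
  also have "\<dots> = (\<mu> \<star> f \<star> f) \<cdot> (f \<star> \<tau> \<star> f) \<cdot> (f \<star> f \<star> \<tau>) \<cdot> (\<tau> \<star> f \<star> f) \<cdot> (f \<star> \<tau> \<star> f) \<cdot> (\<Delta> \<star> f \<star> f)"
    unfolding Delta_tau by simp
  finally show ?thesis .
qed

text \<open>After \<lambda> is expanded, \<open>Delta_tau_mu\<close> produces four crossings in its
  middle. One of them, enclosed by a multiplication and a comultiplication set free by
  (co)associativity, is a new copy of \<lambda>.\<close>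

lemma Delta_lam_mu:
  "(f \<star> \<Delta>) \<cdot> (lam \<cdot> (f \<star> \<mu>)) =
    (\<mu> \<star> f \<star> f) \<cdot> (f \<star> \<tau> \<star> f) \<cdot> (f \<star> f \<star> \<tau>) \<cdot> (lam \<star> f \<star> f) \<cdot> (f \<star> \<tau> \<star> f) \<cdot> (\<Delta> \<star> f \<star> f)"
proof -
  have "(f \<star> \<Delta>) \<cdot> (lam \<cdot> (f \<star> \<mu>))
      = ((f \<star> \<Delta>) \<cdot> (\<mu> \<star> f)) \<cdot> (f \<star> \<tau>) \<cdot> ((\<Delta> \<star> f) \<cdot> (f \<star> \<mu>))"
    by (simp add: lam_eq)
  also have "(f \<star> \<Delta>) \<cdot> (\<mu> \<star> f) = (\<mu> \<star> f \<star> f) \<cdot> (f \<star> f \<star> \<Delta>)"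
    using exchange[of \<Delta> \<mu>] by simp
  also have "(\<Delta> \<star> f) \<cdot> (f \<star> \<mu>) = (f \<star> f \<star> \<mu>) \<cdot> (\<Delta> \<star> f \<star> f)"
    using exchange[of \<mu> \<Delta>] by simp
  also have "(\<mu> \<star> f \<star> f) \<cdot> (f \<star> f \<star> \<Delta>) \<cdot> (f \<star> \<tau>) \<cdot> ((f \<star> f \<star> \<mu>) \<cdot> (\<Delta> \<star> f \<star> f)) =
     (\<mu> \<star> f \<star> f) \<cdot> (f \<star> ((f \<star> \<Delta>) \<cdot> (\<tau> \<cdot> (f \<star> \<mu>)))) \<cdot> (\<Delta> \<star> f \<star> f)" by simp
  also have "\<dots> = ((\<mu> \<cdot> (f \<star> \<mu>)) \<star> f \<star> f) \<cdot> (f \<star> f \<star> \<tau> \<star> f) \<cdot> (f \<star> f \<star> f \<star> \<tau>) \<cdot> (f \<star> \<tau> \<star> f \<star> f)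
       \<cdot> (f \<star> f \<star> \<tau> \<star> f) \<cdot> (((f \<star> \<Delta>) \<cdot> \<Delta>) \<star> f \<star> f)"
    unfolding Delta_tau_mu by simp
  \<comment> \<open>Of the two multiplications and the two comultiplications, the inner ones now act
    on strands disjoint from the neighbouring crossings. The next two slides bring them next to
    \<open>f \<star> \<tau> \<star> f \<star> f\<close>, where they form
    \<open>lam \<star> f \<star> f\<close>.\<close>
  also have "\<dots> = (\<mu> \<star> f \<star> f) \<cdot> ((\<mu> \<star> f \<star> f \<star> f) \<cdot> (f \<star> f \<star> ((\<tau> \<star> f) \<cdot> (f \<star> \<tau>)))) \<cdot> (f \<star> \<tau> \<star> f \<star> f)
       \<cdot> ((f \<star> f \<star> \<tau> \<star> f) \<cdot> (\<Delta> \<star> f \<star> f \<star> f)) \<cdot> (\<Delta> \<star> f \<star> f)"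
    unfolding mu_assoc Delta_coassoc by simp
  also have "(f \<star> f \<star> \<tau> \<star> f) \<cdot> (\<Delta> \<star> f \<star> f \<star> f) = (\<Delta> \<star> f \<star> f \<star> f) \<cdot> (f \<star> \<tau> \<star> f)"
    using exchange[of "\<tau> \<star> f" \<Delta>] by simp
  also have "(\<mu> \<star> f \<star> f \<star> f) \<cdot> (f \<star> f \<star> ((\<tau> \<star> f) \<cdot> (f \<star> \<tau>))) = (f \<star> \<tau> \<star> f) \<cdot> (f \<star> f \<star> \<tau>) \<cdot> (\<mu> \<star> f \<star> f \<star> f)"
    using exchange[of "(\<tau> \<star> f) \<cdot> (f \<star> \<tau>)" \<mu>] by simp
  finally show ?thesis by (simp add: lam_eq)
qed

end

section \<open>The 2-cells \<psi> and \<phi>, the Yetter-Drinfel'd condition and its strong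
  form\<close>

locale braided_module_comodule = braided_bimonad K A
  for K :: "('o, 'c, 't, 'm) two_cat_scheme" (structure) and A +
  fixes X :: 'c and \<sigma> \<rho> \<nu> l \<psi> \<phi> :: 't
  assumes X_one_cell: "one_cell K A A X"
    and sigma_two_cell: "two_cell K (F \<odot> X) (X \<odot> F) \<sigma>"
    and rho_two_cell: "two_cell K (X \<odot> F) (F \<odot> X) \<rho>"
    and nu_two_cell: "two_cell K (F \<odot> X) X \<nu>"
    and l_two_cell: "two_cell K X (F \<odot> X) l"
    and l_sigma: "(l \<star> \<langle>F\<rangle>) \<cdot> \<sigma> = (\<langle>F\<rangle> \<star> \<sigma>) \<cdot> (\<tau> \<star> \<langle>X\<rangle>) \<cdot> (\<langle>F\<rangle> \<star> l)"
    and rho_nu: "\<rho> \<cdot> (\<nu> \<star> \<langle>F\<rangle>) = (\<langle>F\<rangle> \<star> \<nu>) \<cdot> (\<tau> \<star> \<langle>X\<rangle>) \<cdot> (\<langle>F\<rangle> \<star> \<rho>)"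
    and yang_baxter: "(\<langle>F\<rangle> \<star> \<sigma>) \<cdot> (\<tau> \<star> \<langle>X\<rangle>) \<cdot> (\<langle>F\<rangle> \<star> \<rho>)
            = (\<rho> \<star> \<langle>F\<rangle>) \<cdot> (\<langle>X\<rangle> \<star> \<tau>) \<cdot> (\<sigma> \<star> \<langle>F\<rangle>)"
    and sigma_right_comonadic: "right_comonadic K A F \<Delta> \<epsilon> X \<sigma>"
    and rho_right_monadic: "right_monadic K A F \<mu> \<eta> X \<rho>"
    and psi_eq: "\<psi> = (\<nu> \<star> \<langle>F\<rangle>) \<cdot> (\<langle>F\<rangle> \<star> \<sigma>) \<cdot> (\<Delta> \<star> \<langle>X\<rangle>)"
    and phi_eq: "\<phi> = (\<mu> \<star> \<langle>X\<rangle>) \<cdot> (\<langle>F\<rangle> \<star> \<rho>) \<cdot> (l \<star> \<langle>F\<rangle>)"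
begin

abbreviation x :: 't where "x \<equiv> \<langle>X\<rangle>"

lemma X_ob [simp]: "ob X"
  using X_one_cell by (simp add: ob_def)

lemma X_cells [simp]:
  "layer \<sigma>" "dom2 K \<sigma> = F \<odot> X" "cod2 K \<sigma> = X \<odot> F"
  "layer \<rho>" "dom2 K \<rho> = X \<odot> F" "cod2 K \<rho> = F \<odot> X"
  "layer \<nu>" "dom2 K \<nu> = F \<odot> X" "cod2 K \<nu> = X"
  "layer l" "dom2 K l = X" "cod2 K l = F \<odot> X"
  using cellI[OF sigma_two_cell] cellI[OF rho_two_cell] cellI[OF nu_two_cell] cellI[OF l_two_cell]
  by (auto simp: layer_def)

lemma psi_phi_cells [simp]:
  "layer \<psi>" "dom2 K \<psi> = F \<odot> X" "cod2 K \<psi> = X \<odot> F"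
  "layer \<phi>" "dom2 K \<phi> = X \<odot> F" "cod2 K \<phi> = F \<odot> X"
  unfolding layer_def psi_eq phi_eq by simp_all

text \<open>Right monadicity of \<rho> splits the product into two crossings, and associativity lets
  the first of them be absorbed into \<phi>.\<close>

lemma phi_mu: "\<phi> \<cdot> (x \<star> \<mu>) = (\<mu> \<star> x) \<cdot> (f \<star> \<rho>) \<cdot> (\<phi> \<star> f)"
proof -
  have rho_mu: "\<rho> \<cdot> (x \<star> \<mu>) = (\<mu> \<star> x) \<cdot> (f \<star> \<rho>) \<cdot> (\<rho> \<star> f)"
    using rho_right_monadic by (simp only: right_monadic_def)
  have "\<phi> \<cdot> (x \<star> \<mu>) = (\<mu> \<star> x) \<cdot> (f \<star> \<rho>) \<cdot> ((l \<star> f) \<cdot> (x \<star> \<mu>))"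
    by (simp add: phi_eq)
  also have "(l \<star> f) \<cdot> (x \<star> \<mu>) = (f \<star> x \<star> \<mu>) \<cdot> (l \<star> f \<star> f)"
    using exchange[of \<mu> l] by simp
  also have "(\<mu> \<star> x) \<cdot> (f \<star> \<rho>) \<cdot> ((f \<star> x \<star> \<mu>) \<cdot> (l \<star> f \<star> f))
      = (\<mu> \<star> x) \<cdot> (f \<star> (\<rho> \<cdot> (x \<star> \<mu>))) \<cdot> (l \<star> f \<star> f)" by simp
  also have "\<dots> = ((\<mu> \<cdot> (f \<star> \<mu>)) \<star> x) \<cdot> (f \<star> f \<star> \<rho>) \<cdot> (f \<star> \<rho> \<star> f) \<cdot> (l \<star> f \<star> f)"
    unfolding rho_mu by simp
  also have "\<dots> = (\<mu> \<star> x) \<cdot> ((\<mu> \<star> f \<star> x) \<cdot> (f \<star> f \<star> \<rho>)) \<cdot> (f \<star> \<rho> \<star> f) \<cdot> (l \<star> f \<star> f)"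
    unfolding mu_assoc by simp
  also have "(\<mu> \<star> f \<star> x) \<cdot> (f \<star> f \<star> \<rho>) = (f \<star> \<rho>) \<cdot> (\<mu> \<star> x \<star> f)"
    using exchange[of \<rho> \<mu>] by simp
  finally show ?thesis by (simp add: phi_eq)
qed

text \<open>The dual of \<open>phi_mu\<close> under reversal of 2-cells, which swaps \<mu> with
  \<Delta>, \<open>l\<close> with \<nu>, and \<rho> with \<sigma>.\<close>

lemma Delta_psi: "(x \<star> \<Delta>) \<cdot> \<psi> = (\<psi> \<star> f) \<cdot> (f \<star> \<sigma>) \<cdot> (\<Delta> \<star> x)"
proof -
  have Delta_sigma: "(x \<star> \<Delta>) \<cdot> \<sigma> = (\<sigma> \<star> f) \<cdot> (f \<star> \<sigma>) \<cdot> (\<Delta> \<star> x)"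
    using sigma_right_comonadic by (simp only: right_comonadic_def)
  have "(x \<star> \<Delta>) \<cdot> \<psi> = (x \<star> \<Delta>) \<cdot> (\<nu> \<star> f) \<cdot> (f \<star> \<sigma>) \<cdot> (\<Delta> \<star> x)"
    by (simp add: psi_eq)
  also have "(x \<star> \<Delta>) \<cdot> (\<nu> \<star> f) = (\<nu> \<star> f \<star> f) \<cdot> (f \<star> x \<star> \<Delta>)"
    using exchange[of \<Delta> \<nu>] by simp
  also have "\<dots> \<cdot> (f \<star> \<sigma>) \<cdot> (\<Delta> \<star> x) = (\<nu> \<star> f \<star> f) \<cdot> (f \<star> ((x \<star> \<Delta>) \<cdot> \<sigma>)) \<cdot> (\<Delta> \<star> x)"
    by simp
  also have "\<dots> = (\<nu> \<star> f \<star> f) \<cdot> (f \<star> \<sigma> \<star> f) \<cdot> (f \<star> f \<star> \<sigma>) \<cdot> (((f \<star> \<Delta>) \<cdot> \<Delta>) \<star> x)"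
    unfolding Delta_sigma by simp
  also have "\<dots> = (\<nu> \<star> f \<star> f) \<cdot> (f \<star> \<sigma> \<star> f) \<cdot> ((f \<star> f \<star> \<sigma>) \<cdot> (\<Delta> \<star> f \<star> x)) \<cdot> (\<Delta> \<star> x)"
    unfolding Delta_coassoc by simp
  also have "(f \<star> f \<star> \<sigma>) \<cdot> (\<Delta> \<star> f \<star> x) = (\<Delta> \<star> x \<star> f) \<cdot> (f \<star> \<sigma>)"
    using exchange[of \<sigma> \<Delta>] by simp
  finally show ?thesis by (simp add: psi_eq)
qed

text \<open>The counit passes through \<sigma> and cancels the comultiplication. Thus the action
  that the Yetter-Drinfel'd condition extracts from \<psi> is the given \<nu>;
  \<open>phi_unit\<close> is the dual statement for the coaction.\<close>

lemma counit_psi: "(x \<star> \<epsilon>) \<cdot> \<psi> = \<nu>"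
proof -
  have eps: "(x \<star> \<epsilon>) \<cdot> \<sigma> = \<epsilon> \<star> x" "(f \<star> \<epsilon>) \<cdot> \<Delta> = f"
    using sigma_right_comonadic comonad_F by (simp_all add: right_comonadic_def comonad_def)
  have "(x \<star> \<epsilon>) \<cdot> \<psi> = (x \<star> \<epsilon>) \<cdot> (\<nu> \<star> f) \<cdot> (f \<star> \<sigma>) \<cdot> (\<Delta> \<star> x)"
    by (simp add: psi_eq)
  also have "(x \<star> \<epsilon>) \<cdot> (\<nu> \<star> f) = \<nu> \<cdot> (f \<star> x \<star> \<epsilon>)"
    using exchange[of \<epsilon> \<nu>] by simp
  also have "\<dots> \<cdot> (f \<star> \<sigma>) \<cdot> (\<Delta> \<star> x) = \<nu> \<cdot> (f \<star> ((x \<star> \<epsilon>) \<cdot> \<sigma>)) \<cdot> (\<Delta> \<star> x)"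
    by simp
  also have "\<dots> = \<nu> \<cdot> (((f \<star> \<epsilon>) \<cdot> \<Delta>) \<star> x)"
    unfolding eps(1) by simp
  finally show ?thesis by (simp add: eps(2))
qed

lemma phi_unit: "\<phi> \<cdot> (x \<star> \<eta>) = l"
proof -
  have eta: "\<rho> \<cdot> (x \<star> \<eta>) = \<eta> \<star> x" "\<mu> \<cdot> (f \<star> \<eta>) = f"
    using rho_right_monadic monad_F by (simp_all add: right_monadic_def monad_def)
  have "\<phi> \<cdot> (x \<star> \<eta>) = (\<mu> \<star> x) \<cdot> (f \<star> \<rho>) \<cdot> ((l \<star> f) \<cdot> (x \<star> \<eta>))"
    by (simp add: phi_eq)
  also have "(l \<star> f) \<cdot> (x \<star> \<eta>) = (f \<star> x \<star> \<eta>) \<cdot> l"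
    using exchange[of \<eta> l] by simp
  also have "(\<mu> \<star> x) \<cdot> (f \<star> \<rho>) \<cdot> ((f \<star> x \<star> \<eta>) \<cdot> l) = (\<mu> \<star> x) \<cdot> (f \<star> (\<rho> \<cdot> (x \<star> \<eta>))) \<cdot> l"
    by simp
  also have "\<dots> = ((\<mu> \<cdot> (f \<star> \<eta>)) \<star> x) \<cdot> l"
    unfolding eta(1) by simp
  finally show ?thesis by (simp add: eta(2))
qed

text \<open>In the left side of the condition, the unit can be inserted after \<psi> and the counit
  applied before \<phi>. Both then meet at \<lambda>, and \<open>lam_unit_counit\<close> erases all
  three.\<close>

lemma yetter_drinfeld_phi_psi:
  assumes "yetter_drinfeld K A F \<mu> \<eta> \<Delta> \<epsilon> lam X \<psi> \<phi>"
  shows "\<phi> \<cdot> \<psi> = (f \<star> \<nu>) \<cdot> (lam \<star> x) \<cdot> (f \<star> l)"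
proof -
  have "(f \<star> \<nu>) \<cdot> (lam \<star> x) \<cdot> (f \<star> l) = (f \<star> x \<star> \<epsilon>) \<cdot> (\<phi> \<star> f) \<cdot> (x \<star> lam) \<cdot> (\<psi> \<star> \<eta>)"
    using assms by (simp only: yetter_drinfeld_def Let_def counit_psi phi_unit)
  also have "\<psi> \<star> \<eta> = (x \<star> f \<star> \<eta>) \<cdot> \<psi>"
    using inter[of \<eta> "\<langle>id1 K A\<rangle>" "\<langle>X \<odot> F\<rangle>" \<psi>] by simp
  also have "(f \<star> x \<star> \<epsilon>) \<cdot> (\<phi> \<star> f) = \<phi> \<cdot> (x \<star> f \<star> \<epsilon>)"
    using exchange[of \<epsilon> \<phi>] by simp
  also have "\<dots> \<cdot> (x \<star> lam) \<cdot> ((x \<star> f \<star> \<eta>) \<cdot> \<psi>) = \<phi> \<cdot> (x \<star> ((f \<star> \<epsilon>) \<cdot> (lam \<cdot> (f \<star> \<eta>)))) \<cdot> \<psi>"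
    by simp
  finally show ?thesis unfolding lam_unit_counit by simp
qed

lemma strong_from_phi_psi:
  assumes phi_psi: "\<phi> \<cdot> \<psi> = (f \<star> \<nu>) \<cdot> (lam \<star> x) \<cdot> (f \<star> l)"
  shows "(\<phi> \<star> f) \<cdot> (x \<star> lam) \<cdot> (\<psi> \<star> f) = (f \<star> \<psi>) \<cdot> (lam \<star> x) \<cdot> (f \<star> \<phi>)"
proof -
  have "(\<phi> \<star> f) \<cdot> (x \<star> lam) \<cdot> (\<psi> \<star> f)
      = ((\<phi> \<cdot> (x \<star> \<mu>)) \<star> f) \<cdot> (x \<star> f \<star> \<tau>) \<cdot> (((x \<star> \<Delta>) \<cdot> \<psi>) \<star> f)"
    by (simp add: lam_eq)
  also have "\<dots> = (\<mu> \<star> x \<star> f) \<cdot> (f \<star> \<rho> \<star> f) \<cdot> ((\<phi> \<star> f \<star> f) \<cdot> (x \<star> f \<star> \<tau>)) \<cdot> (\<psi> \<star> f \<star> f)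
      \<cdot> (f \<star> \<sigma> \<star> f) \<cdot> (\<Delta> \<star> x \<star> f)"
    unfolding phi_mu Delta_psi by simp
  \<comment> \<open>\<tau> stands between \<phi> and \<psi> but acts on strands disjoint from those
    of \<phi>; moving it after \<phi> makes \<phi> and \<psi> adjacent.\<close>
  also have "(\<phi> \<star> f \<star> f) \<cdot> (x \<star> f \<star> \<tau>) = (f \<star> x \<star> \<tau>) \<cdot> (\<phi> \<star> f \<star> f)"
    using exchange[of \<tau> \<phi>] by simp
  also have "(\<mu> \<star> x \<star> f) \<cdot> (f \<star> \<rho> \<star> f) \<cdot> \<dots> \<cdot> (\<psi> \<star> f \<star> f) \<cdot> (f \<star> \<sigma> \<star> f) \<cdot> (\<Delta> \<star> x \<star> f)
     = (\<mu> \<star> x \<star> f) \<cdot> (f \<star> \<rho> \<star> f) \<cdot> (f \<star> x \<star> \<tau>) \<cdot> ((\<phi> \<cdot> \<psi>) \<star> f \<star> f) \<cdot> (f \<star> \<sigma> \<star> f) \<cdot> (\<Delta> \<star> x \<star> f)"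
    by simp
  \<comment> \<open>The group \<open>(l \<star> f) \<cdot> \<sigma>\<close> is already in the form
    needed by \<open>l_sigma\<close>; for \<open>rho_nu\<close>, \<tau> must first slide to a place
    before \<nu>.\<close>
  also have "\<dots> = (\<mu> \<star> x \<star> f) \<cdot> (f \<star> ((\<rho> \<star> f) \<cdot> ((x \<star> \<tau>) \<cdot> (\<nu> \<star> f \<star> f)))) \<cdot> (lam \<star> x \<star> f \<star> f)
      \<cdot> (f \<star> ((l \<star> f) \<cdot> \<sigma>) \<star> f) \<cdot> (\<Delta> \<star> x \<star> f)"
    unfolding phi_psi by simp
  also have "(x \<star> \<tau>) \<cdot> (\<nu> \<star> f \<star> f) = (\<nu> \<star> f \<star> f) \<cdot> (f \<star> x \<star> \<tau>)"
    using exchange[of \<tau> \<nu>] by simp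
  also have "(\<rho> \<star> f) \<cdot> \<dots> = ((\<rho> \<cdot> (\<nu> \<star> f)) \<star> f) \<cdot> (f \<star> x \<star> \<tau>)"
    by simp
  also have "\<dots> = (f \<star> \<nu> \<star> f) \<cdot> (\<tau> \<star> x \<star> f) \<cdot> (f \<star> \<rho> \<star> f) \<cdot> (f \<star> x \<star> \<tau>)"
    unfolding rho_nu by simp
  also have "(\<mu> \<star> x \<star> f) \<cdot> (f \<star> \<dots>) \<cdot> (lam \<star> x \<star> f \<star> f) \<cdot> (f \<star> ((l \<star> f) \<cdot> \<sigma>) \<star> f) \<cdot> (\<Delta> \<star> x \<star> f)
     = (\<mu> \<star> x \<star> f) \<cdot> (f \<star> f \<star> \<nu> \<star> f) \<cdot> (f \<star> \<tau> \<star> x \<star> f) \<cdot> (f \<star> f \<star> \<rho> \<star> f) \<cdot> (f \<star> f \<star> x \<star> \<tau>)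
      \<cdot> ((lam \<star> x \<star> f \<star> f) \<cdot> (f \<star> f \<star> \<sigma> \<star> f)) \<cdot> (f \<star> \<tau> \<star> x \<star> f)
      \<cdot> ((f \<star> f \<star> l \<star> f) \<cdot> (\<Delta> \<star> x \<star> f))"
    unfolding l_sigma by simp
  \<comment> \<open>\<open>l\<close> moves to the very beginning, where it will become part of
    \<phi>. The slide after this one takes \<sigma> past \<lambda>, next to \<rho> and \<tau>, so
    that the Yang-Baxter equation applies.\<close>
  also have "(f \<star> f \<star> l \<star> f) \<cdot> (\<Delta> \<star> x \<star> f) = (\<Delta> \<star> f \<star> x \<star> f) \<cdot> (f \<star> l \<star> f)"
    using exchange[of "l \<star> f" \<Delta>] by simp
  also have "(lam \<star> x \<star> f \<star> f) \<cdot> (f \<star> f \<star> \<sigma> \<star> f) = (f \<star> f \<star> \<sigma> \<star> f) \<cdot> (lam \<star> f \<star> x \<star> f)"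
    using exchange[of "\<sigma> \<star> f" lam] by simp
  also have "(\<mu> \<star> x \<star> f) \<cdot> (f \<star> f \<star> \<nu> \<star> f) \<cdot> (f \<star> \<tau> \<star> x \<star> f) \<cdot> (f \<star> f \<star> \<rho> \<star> f) \<cdot> (f \<star> f \<star> x \<star> \<tau>)
      \<cdot> \<dots> \<cdot> (f \<star> \<tau> \<star> x \<star> f) \<cdot> ((\<Delta> \<star> f \<star> x \<star> f) \<cdot> (f \<star> l \<star> f))
    = (\<mu> \<star> x \<star> f) \<cdot> (f \<star> f \<star> \<nu> \<star> f) \<cdot> (f \<star> \<tau> \<star> x \<star> f)
      \<cdot> (f \<star> f \<star> ((\<rho> \<star> f) \<cdot> (x \<star> \<tau>) \<cdot> (\<sigma> \<star> f)))
      \<cdot> (lam \<star> f \<star> x \<star> f) \<cdot> (f \<star> \<tau> \<star> x \<star> f) \<cdot> (\<Delta> \<star> f \<star> x \<star> f) \<cdot> (f \<star> l \<star> f)"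
    by simp
  \<comment> \<open>Read from right to left, the Yang-Baxter equation puts \<sigma> last and \<rho>
    first among the three crossings. Each can then leave the middle on its own side, \<sigma>
    towards \<nu> and \<rho> towards \<open>l\<close>.\<close>
  also have "\<dots> = (\<mu> \<star> x \<star> f) \<cdot> (f \<star> f \<star> \<nu> \<star> f) \<cdot> ((f \<star> \<tau> \<star> x \<star> f) \<cdot> (f \<star> f \<star> f \<star> \<sigma>)) \<cdot> (f \<star> f \<star> \<tau> \<star> x)
      \<cdot> ((f \<star> f \<star> f \<star> \<rho>) \<cdot> (((lam \<star> f) \<cdot> (f \<star> \<tau>) \<cdot> (\<Delta> \<star> f)) \<star> x \<star> f)) \<cdot> (f \<star> l \<star> f)"
    unfolding yang_baxter[symmetric] by simp
  also have "(f \<star> f \<star> f \<star> \<rho>) \<cdot> (((lam \<star> f) \<cdot> (f \<star> \<tau>) \<cdot> (\<Delta> \<star> f)) \<star> x \<star> f)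
      = (((lam \<star> f) \<cdot> (f \<star> \<tau>) \<cdot> (\<Delta> \<star> f)) \<star> f \<star> x) \<cdot> (f \<star> f \<star> \<rho>)"
    using exchange[of \<rho> "(lam \<star> f) \<cdot> (f \<star> \<tau>) \<cdot> (\<Delta> \<star> f)"] by simp
  also have "(f \<star> \<tau> \<star> x \<star> f) \<cdot> (f \<star> f \<star> f \<star> \<sigma>) = (f \<star> f \<star> f \<star> \<sigma>) \<cdot> (f \<star> \<tau> \<star> f \<star> x)"
    using exchange[of \<sigma> "f \<star> \<tau>"] by simp
  also have "(\<mu> \<star> x \<star> f) \<cdot> (f \<star> f \<star> \<nu> \<star> f) \<cdot> \<dots> \<cdot> (f \<star> f \<star> \<tau> \<star> x)
      \<cdot> ((((lam \<star> f) \<cdot> (f \<star> \<tau>) \<cdot> (\<Delta> \<star> f)) \<star> f \<star> x) \<cdot> (f \<star> f \<star> \<rho>)) \<cdot> (f \<star> l \<star> f)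
     = ((\<mu> \<star> x \<star> f) \<cdot> (f \<star> f \<star> ((\<nu> \<star> f) \<cdot> (f \<star> \<sigma>)))) \<cdot> (f \<star> \<tau> \<star> f \<star> x) \<cdot> (f \<star> f \<star> \<tau> \<star> x)
      \<cdot> (((lam \<star> f) \<cdot> (f \<star> \<tau>) \<cdot> (\<Delta> \<star> f)) \<star> f \<star> x) \<cdot> (f \<star> f \<star> \<rho>) \<cdot> (f \<star> l \<star> f)"
    by simp
  \<comment> \<open>This leaves \<nu> and \<sigma> as the final factors, in the order in which they
    occur in \<psi>.\<close>
  also have "(\<mu> \<star> x \<star> f) \<cdot> (f \<star> f \<star> ((\<nu> \<star> f) \<cdot> (f \<star> \<sigma>))) = (f \<star> ((\<nu> \<star> f) \<cdot> (f \<star> \<sigma>))) \<cdot> (\<mu> \<star> f \<star> f \<star> x)"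
    using exchange[of "(\<nu> \<star> f) \<cdot> (f \<star> \<sigma>)" \<mu>] by simp
  also have "\<dots> \<cdot> (f \<star> \<tau> \<star> f \<star> x) \<cdot> (f \<star> f \<star> \<tau> \<star> x)
      \<cdot> (((lam \<star> f) \<cdot> (f \<star> \<tau>) \<cdot> (\<Delta> \<star> f)) \<star> f \<star> x) \<cdot> (f \<star> f \<star> \<rho>) \<cdot> (f \<star> l \<star> f)
    = (f \<star> ((\<nu> \<star> f) \<cdot> (f \<star> \<sigma>))) \<cdot> (((\<mu> \<star> f \<star> f) \<cdot> (f \<star> \<tau> \<star> f) \<cdot> (f \<star> f \<star> \<tau>) \<cdot> (lam \<star> f \<star> f)
      \<cdot> (f \<star> \<tau> \<star> f) \<cdot> (\<Delta> \<star> f \<star> f)) \<star> x) \<cdot> (f \<star> f \<star> \<rho>) \<cdot> (f \<star> l \<star> f)"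
    by simp
  \<comment> \<open>The middle is the right side of \<open>Delta_lam_mu\<close>. Folding it back
    supplies the comultiplication that completes \<psi> and the multiplication that completes
    \<phi>, with \<lambda> between them.\<close>
  also have "\<dots> = (f \<star> \<psi>) \<cdot> (lam \<star> x) \<cdot> (f \<star> \<phi>)"
    unfolding Delta_lam_mu[symmetric] by (simp add: psi_eq phi_eq)
  finally show ?thesis .
qed

end

theorem proposition7p10:
  fixes K :: "('o, 'c, 't, 'm) two_cat_scheme" (structure)
    and A :: 'o and F X :: 'c
    and \<mu> \<eta> \<Delta> \<epsilon> lam \<tau>\<^sub>F\<^sub>F \<tau>\<^sub>F\<^sub>X \<tau>\<^sub>X\<^sub>F \<nu> l \<psi> \<phi> :: 't
  assumes "two_category K"
    and "A \<in> Obj K"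
    and "bimonad K A F \<mu> \<eta> \<Delta> \<epsilon> lam"
    and "lam = (\<mu> \<star> \<langle>F\<rangle>) \<cdot> (\<langle>F\<rangle> \<star> \<tau>\<^sub>F\<^sub>F) \<cdot> (\<Delta> \<star> \<langle>F\<rangle>)"
    and "two_cell K (F \<odot> F) (F \<odot> F) \<tau>\<^sub>F\<^sub>F"
    and "left_monadic K A F \<mu> \<eta> F \<tau>\<^sub>F\<^sub>F"
    and "right_monadic K A F \<mu> \<eta> F \<tau>\<^sub>F\<^sub>F"
    and "left_comonadic K A F \<Delta> \<epsilon> F \<tau>\<^sub>F\<^sub>F"
    and "right_comonadic K A F \<Delta> \<epsilon> F \<tau>\<^sub>F\<^sub>F"
    and "one_cell K A A X"
    and "two_cell K (F \<odot> X) (X \<odot> F) \<tau>\<^sub>F\<^sub>X"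
    and "two_cell K (X \<odot> F) (F \<odot> X) \<tau>\<^sub>X\<^sub>F"
    and "left_module K A F \<mu> \<eta> X \<nu>"
    and "left_comodule K A F \<Delta> \<epsilon> X l"
    and a1: "left_monadic K A F \<mu> \<eta> X \<tau>\<^sub>F\<^sub>X"
    and a2: "\<tau>\<^sub>F\<^sub>X \<cdot> (\<langle>F\<rangle> \<star> \<nu>) = (\<nu> \<star> \<langle>F\<rangle>) \<cdot> (\<langle>F\<rangle> \<star> \<tau>\<^sub>F\<^sub>X) \<cdot> (\<tau>\<^sub>F\<^sub>F \<star> \<langle>X\<rangle>)"
    and b1: "left_comonadic K A F \<Delta> \<epsilon> X \<tau>\<^sub>X\<^sub>F"
    and b2: "(\<langle>F\<rangle> \<star> l) \<cdot> \<tau>\<^sub>X\<^sub>F = (\<tau>\<^sub>F\<^sub>F \<star> \<langle>X\<rangle>) \<cdot> (\<langle>F\<rangle> \<star> \<tau>\<^sub>X\<^sub>F) \<cdot> (l \<star> \<langle>F\<rangle>)"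
    and c1: "right_comonadic K A F \<Delta> \<epsilon> X \<tau>\<^sub>F\<^sub>X"
    and c2: "(l \<star> \<langle>F\<rangle>) \<cdot> \<tau>\<^sub>F\<^sub>X = (\<langle>F\<rangle> \<star> \<tau>\<^sub>F\<^sub>X) \<cdot> (\<tau>\<^sub>F\<^sub>F \<star> \<langle>X\<rangle>) \<cdot> (\<langle>F\<rangle> \<star> l)"
    and d1: "right_monadic K A F \<mu> \<eta> X \<tau>\<^sub>X\<^sub>F"
    and d2: "\<tau>\<^sub>X\<^sub>F \<cdot> (\<nu> \<star> \<langle>F\<rangle>) = (\<langle>F\<rangle> \<star> \<nu>) \<cdot> (\<tau>\<^sub>F\<^sub>F \<star> \<langle>X\<rangle>) \<cdot> (\<langle>F\<rangle> \<star> \<tau>\<^sub>X\<^sub>F)"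
    and e: "(\<langle>F\<rangle> \<star> \<tau>\<^sub>F\<^sub>X) \<cdot> (\<tau>\<^sub>F\<^sub>F \<star> \<langle>X\<rangle>) \<cdot> (\<langle>F\<rangle> \<star> \<tau>\<^sub>X\<^sub>F)
            = (\<tau>\<^sub>X\<^sub>F \<star> \<langle>F\<rangle>) \<cdot> (\<langle>X\<rangle> \<star> \<tau>\<^sub>F\<^sub>F) \<cdot> (\<tau>\<^sub>F\<^sub>X \<star> \<langle>F\<rangle>)"
    and "\<psi> = (\<nu> \<star> \<langle>F\<rangle>) \<cdot> (\<langle>F\<rangle> \<star> \<tau>\<^sub>F\<^sub>X) \<cdot> (\<Delta> \<star> \<langle>X\<rangle>)"
    and "\<phi> = (\<mu> \<star> \<langle>X\<rangle>) \<cdot> (\<langle>F\<rangle> \<star> \<tau>\<^sub>X\<^sub>F) \<cdot> (l \<star> \<langle>F\<rangle>)"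
    and "yetter_drinfeld K A F \<mu> \<eta> \<Delta> \<epsilon> lam X \<psi> \<phi>"
  shows "strong_yetter_drinfeld K A F \<mu> \<eta> \<Delta> \<epsilon> lam X \<psi> \<phi>"
proof -
  interpret two_category K by fact
  interpret braided_module_comodule F \<mu> \<eta> \<Delta> \<epsilon> \<tau>\<^sub>F\<^sub>F lam K A X \<tau>\<^sub>F\<^sub>X \<tau>\<^sub>X\<^sub>F \<nu> l \<psi> \<phi>
    by unfold_locales (use assms in \<open>auto simp: bimonad_def left_module_def left_comodule_def\<close>)
  show ?thesis
    unfolding strong_yetter_drinfeld_def
    using assms strong_from_phi_psi[OF yetter_drinfeld_phi_psi] by blast
qed

end
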